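(* Let $\mathcal{A}\in\mathbb{C}^{\mathbf{N}(n)\times\mathbf{N}(n)}$ be a core tensor and let $\mathcal{B}\in\mathbb{C}^{\mathbf{N}(n)}$ with $\mathcal{B}\in\mathscr{R}(\mathcal{A})$. Then the tensor equation $\mathcal{A}*_n\mathcal{X}=\mathcal{B}$ (in the unknown $\mathcal{X}\in\mathbb{C}^{\mathbf{N}(n)}$) has a unique solution in $\mathscr{R}(\mathcal{A})$, and it is given by $\mathcal{X}=\mathcal{A}^{\mathrm{core}}*_n\mathcal{B}$.
   Context: Here $\mathbf{N}(n)=N_1\times\cdots\times N_n$, $\mathbb{C}^{\mathbf{N}(n)}$ is the set of complex tensors $(x_{i_1\ldots i_n})$ and $\mathbb{C}^{\mathbf{N}(n)\times\mathbf{N}(n)}$ the set of complex tensors $\mathcal{A}=(a_{i_1\ldots i_n j_1\ldots j_n})$, with $1\le i_k,j_k\le N_k$. The Einstein product is $(\mathcal{A}*_n\mathcal{B})_{i_1\ldots i_n j_1\ldots j_n}=\sum_{k_1,\ldots,k_n}a_{i_1\ldots i_n k_1\ldots k_n}b_{k_1\ldots k_n j_1\ldots j_n}$, and for $\mathcal{X}\in\mathbb{C}^{\mathbf{N}(n)}$, $(\mathcal{A}*_n\mathcal{X})_{i_1\ldots i_n}=\sum_{k_1,\ldots,k_n}a_{i_1\ldots i_nk_1\ldots k_n}x_{k_1\ldots k_n}$. Powers are taken with respect to $*_n$, and $\mathcal{A}^*$ is the conjugate transpose (swap the first $n$ and last $n$ indices and conjugate). The range is $\mathscr{R}(\mathcal{A})=\{\mathcal{A}*_n\mathcal{X}:\mathcal{X}\in\mathbb{C}^{\mathbf{N}(n)}\}$.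 The index $\mathrm{ind}(\mathcal{A})$ is the smallest positive integer $k$ with $\mathscr{R}(\mathcal{A}^k)=\mathscr{R}(\mathcal{A}^{k+1})$; $\mathcal{A}$ is a core tensor if $\mathrm{ind}(\mathcal{A})=1$. The core inverse $\mathcal{A}^{\mathrm{core}}$ is the (unique, existing when $\mathcal{A}$ is a core tensor) tensor $\mathcal{X}\in\mathbb{C}^{\mathbf{N}(n)\times\mathbf{N}(n)}$ with $(\mathcal{A}*_n\mathcal{X})^*=\mathcal{A}*_n\mathcal{X}$, $\mathcal{X}*_n\mathcal{A}^2=\mathcal{A}$, $\mathcal{A}*_n\mathcal{X}^2=\mathcal{X}$. *)

theory Defs
  imports Complex_Main "HOL-Library.FuncSet"
begin

text \<open>Multi-indices $(i_1,\ldots,i_n)$ with $1 \le i_k \le N_k$, as extensional functions on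
  \<open>{1..n}\<close>. Tensors are in turn extensional functions on multi-indices, so that equality
  of tensors is equality of all entries. An entry $a_{i_1 \ldots i_n j_1 \ldots j_n}$
  is written \<open>A (i, j)\<close>.\<close>

type_synonym multi_index = "nat \<Rightarrow> nat"

definition multi_indices :: "nat \<Rightarrow> (nat \<Rightarrow> nat) \<Rightarrow> multi_index set" where
  "multi_indices n N = (\<Pi>\<^sub>E k\<in>{1..n}. {1..N k})"

definition tensors :: "nat \<Rightarrow> (nat \<Rightarrow> nat) \<Rightarrow> (multi_index \<Rightarrow> complex) set" where
  "tensors n N = multi_indices n N \<rightarrow>\<^sub>E UNIV"

definition square_tensors ::
    "nat \<Rightarrow> (nat \<Rightarrow> nat) \<Rightarrow> (multi_index \<times> multi_index \<Rightarrow> complex) set" where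
  "square_tensors n N = (multi_indices n N \<times> multi_indices n N) \<rightarrow>\<^sub>E UNIV"

definition einstein_prod ::
    "nat \<Rightarrow> (nat \<Rightarrow> nat) \<Rightarrow> (multi_index \<times> multi_index \<Rightarrow> complex) \<Rightarrow>
     (multi_index \<times> multi_index \<Rightarrow> complex) \<Rightarrow> (multi_index \<times> multi_index \<Rightarrow> complex)" where
  "einstein_prod n N A B =
     (\<lambda>(i, j)\<in>multi_indices n N \<times> multi_indices n N. \<Sum>k\<in>multi_indices n N. A (i, k) * B (k, j))"

definition einstein_app ::
    "nat \<Rightarrow> (nat \<Rightarrow> nat) \<Rightarrow> (multi_index \<times> multi_index \<Rightarrow> complex) \<Rightarrow>
     (multi_index \<Rightarrow> complex) \<Rightarrow> (multi_index \<Rightarrow> complex)" where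
  "einstein_app n N A X =
     (\<lambda>i\<in>multi_indices n N. \<Sum>k\<in>multi_indices n N. A (i, k) * X k)"

definition tensor_id ::
    "nat \<Rightarrow> (nat \<Rightarrow> nat) \<Rightarrow> (multi_index \<times> multi_index \<Rightarrow> complex)" where
  "tensor_id n N =
     (\<lambda>(i, j)\<in>multi_indices n N \<times> multi_indices n N. if i = j then 1 else 0)"

primrec tensor_power ::
    "nat \<Rightarrow> (nat \<Rightarrow> nat) \<Rightarrow> (multi_index \<times> multi_index \<Rightarrow> complex) \<Rightarrow> nat \<Rightarrow>
     (multi_index \<times> multi_index \<Rightarrow> complex)" where
  "tensor_power n N A 0 = tensor_id n N"
| "tensor_power n N A (Suc k) = einstein_prod n N (tensor_power n N A k) A"

definition conj_transpose ::
    "nat \<Rightarrow> (nat \<Rightarrow> nat) \<Rightarrow> (multi_index \<times> multi_index \<Rightarrow> complex) \<Rightarrow>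
     (multi_index \<times> multi_index \<Rightarrow> complex)" where
  "conj_transpose n N A =
     (\<lambda>(i, j)\<in>multi_indices n N \<times> multi_indices n N. cnj (A (j, i)))"

definition tensor_range ::
    "nat \<Rightarrow> (nat \<Rightarrow> nat) \<Rightarrow> (multi_index \<times> multi_index \<Rightarrow> complex) \<Rightarrow>
     (multi_index \<Rightarrow> complex) set" where
  "tensor_range n N A = {einstein_app n N A X | X. X \<in> tensors n N}"

definition tensor_ind ::
    "nat \<Rightarrow> (nat \<Rightarrow> nat) \<Rightarrow> (multi_index \<times> multi_index \<Rightarrow> complex) \<Rightarrow> nat" where
  "tensor_ind n N A =
     (LEAST k. 0 < k \<and>
        tensor_range n N (tensor_power n N A k) = tensor_range n N (tensor_power n N A (k + 1)))"

definition core_tensor ::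
    "nat \<Rightarrow> (nat \<Rightarrow> nat) \<Rightarrow> (multi_index \<times> multi_index \<Rightarrow> complex) \<Rightarrow> bool" where
  "core_tensor n N A \<longleftrightarrow> A \<in> square_tensors n N \<and> tensor_ind n N A = 1"

definition is_core_inverse ::
    "nat \<Rightarrow> (nat \<Rightarrow> nat) \<Rightarrow> (multi_index \<times> multi_index \<Rightarrow> complex) \<Rightarrow>
     (multi_index \<times> multi_index \<Rightarrow> complex) \<Rightarrow> bool" where
  "is_core_inverse n N A X \<longleftrightarrow>
     X \<in> square_tensors n N \<and>
     conj_transpose n N (einstein_prod n N A X) = einstein_prod n N A X \<and>
     einstein_prod n N X (tensor_power n N A 2) = A \<and>
     einstein_prod n N A (tensor_power n N X 2) = X"

text \<open>Meaningful only for core tensors, for which such a tensor exists and is unique.\<close>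

definition core_inverse ::
    "nat \<Rightarrow> (nat \<Rightarrow> nat) \<Rightarrow> (multi_index \<times> multi_index \<Rightarrow> complex) \<Rightarrow>
     (multi_index \<times> multi_index \<Rightarrow> complex)" where
  "core_inverse n N A = (THE X. is_core_inverse n N A X)"

end

theory Submission
  imports Defs
begin

text \<open>
  Under the Einstein product the square tensors form a finite-dimensional algebra with involution,
  and the argument takes place almost entirely in that algebra.

  Once a core inverse \<open>C\<close> of \<open>A\<close> is known, the equation is solved by direct computation. The defining
  identities give \<open>A C A = A\<close>. Hence for \<open>B = A Z\<close> the tensor \<open>C B = A C\<^sup>2 B\<close> lies in the range of \<open>A\<close>
  and \<open>A C B = A C A Z = B\<close>; and if \<open>X = A W\<close> also satisfies \<open>A X = B\<close>, then
  \<open>C B = C A\<^sup>2 W = A W = X\<close>.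

  What remains is that a core tensor has exactly one core inverse. Uniqueness
  (\<open>core_inverse_unique\<close>) is algebraic. For existence, the only input from finite dimension is that
  the powers of a square tensor \<open>M\<close> are linearly dependent, which yields (\<open>strongly_pi_regular\<close>) an
  exponent \<open>r\<close> and a polynomial \<open>S\<close> in \<open>M\<close> with \<open>M\<^sup>r = M\<^sup>r\<^sup>+\<^sup>1 S\<close>. It is used three times.

  \<^item> The ranges of the powers of \<open>A\<close> stabilise, so that index 1 really means
    \<open>R(A) = R(A\<^sup>2)\<close> (\<open>core_tensor_range\<close>).
  \<^item> Then \<open>A = A\<^sup>2 Y\<close> for some \<open>Y\<close>, so \<open>A = A\<^sup>r\<^sup>+\<^sup>1 Y\<^sup>r\<close>, and \<open>S\<close> can be moved past the powers of \<open>A\<close> to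
    give \<open>A = A S A\<close>. So \<open>G = S\<close> is an inner inverse of \<open>A\<close> that commutes with \<open>A\<close>
    (\<open>core_tensor_commuting_inner_inverse\<close>).
  \<^item> Applied to \<open>H = A\<^sup>\<dagger> A\<close>, it gives \<open>H\<^sup>r = H\<^sup>r\<^sup>+\<^sup>1 S\<close>. Positivity allows left factors \<open>H\<close> to be
    cancelled down to one, so \<open>H = H\<^sup>2 S\<close> and, cancelling \<open>A\<^sup>\<dagger>\<close> as well, \<open>A = A H S\<close>. Hence
    \<open>X = S\<^sup>\<dagger> A\<^sup>\<dagger>\<close> solves \<open>A\<^sup>\<dagger> A X = A\<^sup>\<dagger>\<close>, which says that \<open>A X A = A\<close> with \<open>A X\<close> Hermitian
    (\<open>hermitian_inner_inverse\<close>).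

  The core inverse is \<open>G A X\<close>.
\<close>

section \<open>Linear dependence\<close>

lemma underdetermined_system:
  fixes f :: "'k \<Rightarrow> 'j \<Rightarrow> complex"
  assumes "finite J" "finite K" "card J < card K"
  shows "\<exists>c. (\<exists>k\<in>K. c k \<noteq> 0) \<and> (\<forall>j\<in>J. (\<Sum>k\<in>K. c k * f k j) = 0)"
  using assms
proof (induction J arbitrary: K f rule: finite_induct)
  case empty
  then have "K \<noteq> {}" by auto
  then show ?case by (intro exI[of _ "\<lambda>_. 1"]) auto
next
  case (insert a J)
  show ?case
  proof (cases "\<forall>k\<in>K. f k a = 0")
    case True
    from insert.prems insert.hyps have "card J < card K" by simp
    from insert.IH[OF insert.prems(1) this, of f] obtain c
      where "\<exists>k\<in>K. c k \<noteq> 0" "\<forall>j\<in>J. (\<Sum>k\<in>K. c k * f k j) = 0" by blast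
    with True show ?thesis by (intro exI[of _ c]) auto
  next
    case False
    then obtain p where p: "p \<in> K" "f p a \<noteq> 0" by blast
    \<comment> \<open>One step of Gaussian elimination with pivot equation \<open>a\<close> and pivot unknown \<open>p\<close>.\<close>
    define g where "g k j = f k j - f k a / f p a * f p j" for k j
    have "card J < card (K - {p})" using insert.prems insert.hyps p by simp
    with insert.IH[of "K - {p}" g] insert.prems obtain c where
      c: "\<exists>k\<in>K-{p}. c k \<noteq> 0" "\<forall>j\<in>J. (\<Sum>k\<in>K-{p}. c k * g k j) = 0" by auto
    define d where "d = c (p := - (\<Sum>k\<in>K-{p}. c k * f k a) / f p a)"
    have split: "(\<Sum>k\<in>K. d k * f k j)
        = d p * f p j + (\<Sum>k\<in>K-{p}. c k * f k j)" for j
    proof -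
      have "(\<Sum>k\<in>K. d k * f k j) = d p * f p j + (\<Sum>k\<in>K-{p}. d k * f k j)"
        using p insert.prems by (simp add: sum.remove)
      also have "(\<Sum>k\<in>K-{p}. d k * f k j) = (\<Sum>k\<in>K-{p}. c k * f k j)"
        by (rule sum.cong) (auto simp: d_def)
      finally show ?thesis .
    qed
    have "(\<Sum>k\<in>K. d k * f k a) = 0"
      unfolding split using p by (simp add: d_def)
    moreover have "(\<Sum>k\<in>K. d k * f k j) = 0" if "j \<in> J" for j
    proof -
      have "(\<Sum>k\<in>K-{p}. c k * g k j)
          = (\<Sum>k\<in>K-{p}. c k * f k j) - (\<Sum>k\<in>K-{p}. c k * f k a) / f p a * f p j"
        by (simp add: g_def right_diff_distrib sum_subtractf sum_distrib_right sum_divide_distrib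
            mult.assoc)
      then show ?thesis unfolding split using c(2) that by (simp add: d_def)
    qed
    moreover have "\<exists>k\<in>K. d k \<noteq> 0" using c(1) by (auto simp: d_def)
    ultimately show ?thesis by (intro exI[of _ d]) auto
  qed
qed

context
  fixes n :: nat and N :: "nat \<Rightarrow> nat"
begin

private abbreviation (input) I where "I \<equiv> multi_indices n N"
private abbreviation (input) T where "T \<equiv> square_tensors n N"
private abbreviation (input) prd (infixl "\<odot>" 70) where "A \<odot> B \<equiv> einstein_prod n N A B"
private abbreviation (input) app (infixr "\<cdot>" 65) where "A \<cdot> X \<equiv> einstein_app n N A X"
private abbreviation (input) pow (infixr "\<up>" 80) where "A \<up> k \<equiv> tensor_power n N A k"
private abbreviation (input) adj ("_\<^sup>\<dagger>" [1000] 1000) where "A\<^sup>\<dagger> \<equiv> conj_transpose n N A"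
private abbreviation (input) one ("\<one>") where "\<one> \<equiv> tensor_id n N"

section \<open>The algebra of square tensors\<close>

lemma finite_multi_indices: "finite I"
  unfolding multi_indices_def by (intro finite_PiE) auto

lemma square_tensor_eqI:
  assumes "A \<in> T" "B \<in> T" "\<And>i j. i \<in> I \<Longrightarrow> j \<in> I \<Longrightarrow> A (i, j) = B (i, j)"
  shows "A = B"
  using assms unfolding square_tensors_def by (intro PiE_ext[of A]) auto

lemma tensor_eqI:
  assumes "X \<in> tensors n N" "Y \<in> tensors n N" "\<And>i. i \<in> I \<Longrightarrow> X i = Y i"
  shows "X = Y"
  using assms unfolding tensors_def by (intro PiE_ext[of X]) auto

lemma prod_entry: "i \<in> I \<Longrightarrow> j \<in> I \<Longrightarrow> (A \<odot> B) (i, j) = (\<Sum>k\<in>I. A (i, k) * B (k, j))"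
  by (simp add: einstein_prod_def)

lemma app_entry: "i \<in> I \<Longrightarrow> (A \<cdot> X) i = (\<Sum>k\<in>I. A (i, k) * X k)"
  by (simp add: einstein_app_def)

lemma adj_entry: "i \<in> I \<Longrightarrow> j \<in> I \<Longrightarrow> (A\<^sup>\<dagger>) (i, j) = cnj (A (j, i))"
  by (simp add: conj_transpose_def)

lemma one_entry: "i \<in> I \<Longrightarrow> j \<in> I \<Longrightarrow> \<one> (i, j) = (if i = j then 1 else 0)"
  by (simp add: tensor_id_def)

lemma prod_in [simp, intro]: "A \<odot> B \<in> T"
  by (auto simp: einstein_prod_def square_tensors_def)

lemma adj_in [simp, intro]: "A\<^sup>\<dagger> \<in> T"
  by (auto simp: conj_transpose_def square_tensors_def)

lemma one_in [simp, intro]: "\<one> \<in> T"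
  by (auto simp: tensor_id_def square_tensors_def)

lemma pow_in [simp, intro]: "A \<up> k \<in> T"
  by (cases k) auto

lemma app_in [simp, intro]: "A \<cdot> X \<in> tensors n N"
  by (auto simp: einstein_app_def tensors_def)

lemma prod_assoc: "A \<odot> B \<odot> C = A \<odot> (B \<odot> C)"
proof (rule square_tensor_eqI)
  fix i j assume ij: "i \<in> I" "j \<in> I"
  have "(A \<odot> B \<odot> C) (i, j) = (\<Sum>k\<in>I. \<Sum>l\<in>I. A (i, l) * B (l, k) * C (k, j))"
    using ij by (simp add: prod_entry sum_distrib_right)
  also have "\<dots> = (\<Sum>l\<in>I. \<Sum>k\<in>I. A (i, l) * B (l, k) * C (k, j))" by (rule sum.swap)
  also have "\<dots> = (A \<odot> (B \<odot> C)) (i, j)"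
    using ij by (simp add: prod_entry sum_distrib_left mult.assoc)
  finally show "(A \<odot> B \<odot> C) (i, j) = (A \<odot> (B \<odot> C)) (i, j)" .
qed auto

lemma app_app: "A \<cdot> B \<cdot> X = (A \<odot> B) \<cdot> X"
proof (rule tensor_eqI)
  fix i assume i: "i \<in> I"
  have "((A \<odot> B) \<cdot> X) i = (\<Sum>k\<in>I. \<Sum>l\<in>I. A (i, l) * B (l, k) * X k)"
    using i by (simp add: prod_entry app_entry sum_distrib_right)
  also have "\<dots> = (\<Sum>l\<in>I. \<Sum>k\<in>I. A (i, l) * B (l, k) * X k)" by (rule sum.swap)
  also have "\<dots> = (A \<cdot> B \<cdot> X) i"
    using i by (simp add: app_entry sum_distrib_left mult.assoc)
  finally show "(A \<cdot> B \<cdot> X) i = ((A \<odot> B) \<cdot> X) i" by simp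
qed auto

lemma one_prod [simp]: "A \<in> T \<Longrightarrow> \<one> \<odot> A = A"
  by (rule square_tensor_eqI)
    (auto simp: prod_entry one_entry finite_multi_indices if_distrib[of "\<lambda>x. x * _"] sum.delta cong: if_cong)

lemma prod_one [simp]: "A \<in> T \<Longrightarrow> A \<odot> \<one> = A"
  by (rule square_tensor_eqI)
    (auto simp: prod_entry one_entry finite_multi_indices if_distrib[of "\<lambda>x. _ * x"] sum.delta cong: if_cong)

lemma adj_prod: "(A \<odot> B)\<^sup>\<dagger> = B\<^sup>\<dagger> \<odot> A\<^sup>\<dagger>"
  by (rule square_tensor_eqI) (auto simp: prod_entry adj_entry mult.commute)

lemma adj_adj: "A \<in> T \<Longrightarrow> A\<^sup>\<dagger>\<^sup>\<dagger> = A"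
  by (rule square_tensor_eqI) (auto simp: adj_entry)

lemma pow_add: "A \<up> (k + l) = A \<up> k \<odot> A \<up> l"
  by (induction l) (simp_all add: prod_assoc)

lemma pow_two: "A \<in> T \<Longrightarrow> A \<up> 2 = A \<odot> A"
  by (simp add: numeral_2_eq_2)

lemma pow_Suc_left: "A \<in> T \<Longrightarrow> A \<up> Suc k = A \<odot> A \<up> k"
  using pow_add[of A 1 k] by simp

lemma pow_commute:
  assumes "A \<in> T" "S \<in> T" "A \<odot> S = S \<odot> A"
  shows "A \<up> k \<odot> S = S \<odot> A \<up> k"
proof (induction k)
  case (Suc k)
  then show ?case using assms(3) by (simp add: prod_assoc) (simp flip: prod_assoc)
qed (use assms in simp)

section \<open>Regularity of powers and stabilisation of ranges\<close>

text \<open>The tensor \<open>S\<close> is a polynomial in \<open>A\<close>, obtained by dividing a linear relation between powers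
  of \<open>A\<close> by its lowest-order coefficient.\<close>

lemma strongly_pi_regular:
  assumes A: "A \<in> T"
  obtains r S where "S \<in> T" "A \<odot> S = S \<odot> A" "A \<up> r = A \<up> Suc r \<odot> S"
proof -
  define d where "d = card (I \<times> I)"
  have "card (I \<times> I) < card {..d}" by (simp add: d_def)
  from underdetermined_system[OF _ _ this, of "\<lambda>k. A \<up> k"] obtain c where
    ne: "\<exists>k\<le>d. c k \<noteq> 0" and rel: "\<And>i j. i \<in> I \<Longrightarrow> j \<in> I \<Longrightarrow> (\<Sum>k\<le>d. c k * (A \<up> k) (i, j)) = 0"
    by (auto simp: finite_multi_indices)
  define r where "r = (LEAST k. k \<le> d \<and> c k \<noteq> 0)"
  have r: "r \<le> d" "c r \<noteq> 0" using LeastI_ex[OF ne[simplified Bex_def]] by (auto simp: r_def)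
  have low: "c k = 0" if "k < r" for k
    using not_less_Least[of k "\<lambda>k. k \<le> d \<and> c k \<noteq> 0"] that r(1) by (auto simp: r_def)
  define e where "e l = - c (Suc r + l) / c r" for l
  define S where "S = (\<lambda>(i, j)\<in>I \<times> I. \<Sum>l<d-r. e l * (A \<up> l) (i, j))"
  have S: "S \<in> T" by (auto simp: S_def square_tensors_def)
  have S_entry: "S (i, j) = (\<Sum>l<d-r. e l * (A \<up> l) (i, j))" if "i \<in> I" "j \<in> I" for i j
    using that by (simp add: S_def)
  have left: "(P \<odot> S) (i, j) = (\<Sum>l<d-r. e l * (P \<odot> A \<up> l) (i, j))" if "i \<in> I" "j \<in> I" for P i j
    using that
    by (simp add: prod_entry S_entry sum_distrib_left mult.left_commute)
      (rule sum.swap)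
  have right: "(S \<odot> P) (i, j) = (\<Sum>l<d-r. e l * (A \<up> l \<odot> P) (i, j))" if "i \<in> I" "j \<in> I" for P i j
    using that
    by (simp add: prod_entry S_entry sum_distrib_left sum_distrib_right mult.assoc)
      (rule sum.swap)
  have "A \<odot> S = S \<odot> A"
  proof (rule square_tensor_eqI)
    fix i j assume "i \<in> I" "j \<in> I"
    then show "(A \<odot> S) (i, j) = (S \<odot> A) (i, j)"
      unfolding left[OF \<open>i \<in> I\<close> \<open>j \<in> I\<close>] right[OF \<open>i \<in> I\<close> \<open>j \<in> I\<close>] using pow_Suc_left[OF A] by simp
  qed auto
  moreover have "A \<up> r = A \<up> Suc r \<odot> S"
  proof (rule square_tensor_eqI)
    fix i j assume ij: "i \<in> I" "j \<in> I"
    have "0 = (\<Sum>k\<in>{r..d}. c k * (A \<up> k) (i, j))"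
      unfolding rel[OF ij, symmetric] by (rule sum.mono_neutral_right) (auto simp: low not_le)
    also have "\<dots> = c r * (A \<up> r) (i, j) + (\<Sum>k\<in>{Suc r..d}. c k * (A \<up> k) (i, j))"
      using r(1) by (simp add: sum.atLeast_Suc_atMost del: tensor_power.simps)
    also have "(\<Sum>k\<in>{Suc r..d}. c k * (A \<up> k) (i, j))
        = (\<Sum>l<d-r. c (Suc r + l) * (A \<up> (Suc r + l)) (i, j))"
      by (rule sum.reindex_bij_witness[of _ "\<lambda>l. Suc r + l" "\<lambda>k. k - Suc r"]) auto
    also have "\<dots> = - c r * (A \<up> Suc r \<odot> S) (i, j)"
      unfolding left[OF ij] sum_distrib_left pow_add[symmetric]
      using r(2) by (intro sum.cong) (auto simp: e_def)
    finally have "c r * ((A \<up> r) (i, j) - (A \<up> Suc r \<odot> S) (i, j)) = 0"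
      by (simp add: right_diff_distrib)
    with r(2) show "(A \<up> r) (i, j) = (A \<up> Suc r \<odot> S) (i, j)" by simp
  qed auto
  ultimately show ?thesis using that S by blast
qed

lemma range_prod_subset: "tensor_range n N (A \<odot> B) \<subseteq> tensor_range n N A"
  by (auto simp: tensor_range_def app_app[symmetric])

lemma core_tensor_range:
  assumes "core_tensor n N A"
  shows "tensor_range n N A = tensor_range n N (A \<odot> A)"
proof -
  have A: "A \<in> T" and ind: "tensor_ind n N A = 1"
    using assms by (auto simp: core_tensor_def)
  obtain r S where "S \<in> T" and S: "A \<up> r = A \<up> Suc r \<odot> S"
    using strongly_pi_regular[OF A] by blast
  \<comment> \<open>Multiplying by \<open>A\<close> makes the exponent positive, as the index requires.\<close>
  have "A \<up> Suc r = A \<up> Suc (Suc r) \<odot> S"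
    by (metis S pow_Suc_left[OF A] prod_assoc)
  then have "tensor_range n N (A \<up> Suc r) \<subseteq> tensor_range n N (A \<up> Suc (Suc r))"
    using range_prod_subset by metis
  moreover have "tensor_range n N (A \<up> Suc (Suc r)) \<subseteq> tensor_range n N (A \<up> Suc r)"
    unfolding tensor_power.simps(2)[of n N A "Suc r"] by (rule range_prod_subset)
  ultimately have "\<exists>k. 0 < k \<and> tensor_range n N (A \<up> k) = tensor_range n N (A \<up> (k + 1))"
    by (intro exI[of _ "Suc r"]) auto
  from LeastI_ex[OF this] ind have "tensor_range n N (A \<up> 1) = tensor_range n N (A \<up> (1 + 1))"
    unfolding tensor_ind_def[symmetric] by simp
  then show ?thesis using A by simp
qed

lemma range_subset_factor:
  assumes A: "A \<in> T" and sub: "tensor_range n N A \<subseteq> tensor_range n N M"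
  obtains Y where "Y \<in> T" "A = M \<odot> Y"
proof -
  have "\<exists>x. \<forall>i\<in>I. A (i, j) = (M \<cdot> x) i" if j: "j \<in> I" for j
  proof -
    \<comment> \<open>The \<open>j\<close>-th column of \<open>A\<close> is the image of the \<open>j\<close>-th unit tensor.\<close>
    define u where "u = (\<lambda>k\<in>I. if k = j then 1 else 0 :: complex)"
    have "A \<cdot> u \<in> tensor_range n N A"
      by (auto simp: tensor_range_def tensors_def u_def)
    with sub obtain x where "A \<cdot> u = M \<cdot> x" by (auto simp: tensor_range_def)
    moreover have "(A \<cdot> u) i = A (i, j)" if "i \<in> I" for i
    proof -
      have "(A \<cdot> u) i = (\<Sum>k\<in>I. if k = j then A (i, k) else 0)"
        using that by (auto simp: app_entry u_def intro!: sum.cong)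
      then show ?thesis using j finite_multi_indices by simp
    qed
    ultimately show ?thesis by metis
  qed
  then obtain x where x: "\<And>j i. j \<in> I \<Longrightarrow> i \<in> I \<Longrightarrow> A (i, j) = (M \<cdot> x j) i"
    by metis
  define Y where "Y = (\<lambda>(k, j)\<in>I \<times> I. x j k)"
  have "Y \<in> T" by (auto simp: Y_def square_tensors_def)
  moreover have "A = M \<odot> Y"
    using A by (intro square_tensor_eqI) (auto simp: x prod_entry app_entry Y_def)
  ultimately show ?thesis using that by blast
qed

section \<open>Commuting inner inverses\<close>

lemma core_tensor_commuting_inner_inverse:
  assumes "core_tensor n N A"
  obtains G where "G \<in> T" "A \<odot> G = G \<odot> A" "A \<odot> G \<odot> A = A"
proof -
  have A: "A \<in> T" using assms by (simp add: core_tensor_def)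
  obtain Y where Y: "Y \<in> T" "A = A \<odot> A \<odot> Y"
    using range_subset_factor[OF A, of "A \<odot> A"] core_tensor_range[OF assms] by auto
  obtain r S where S: "S \<in> T" "A \<odot> S = S \<odot> A" "A \<up> r = A \<up> Suc r \<odot> S"
    using strongly_pi_regular[OF A] by blast
  have "A = A \<up> Suc t \<odot> Y \<up> t" for t
  proof (induction t)
    case (Suc t)
    have "A \<up> Suc (Suc t) \<odot> Y \<up> Suc t = A \<up> t \<odot> (A \<odot> A \<odot> Y) \<odot> Y \<up> t"
      using pow_Suc_left[OF Y(1)] by (simp add: prod_assoc)
    also have "\<dots> = A \<up> Suc t \<odot> Y \<up> t" using Y(2)[symmetric] by simp
    also have "\<dots> = A" using Suc[symmetric] .
    finally show ?case by simp
  qed (use A in simp)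
  \<comment> \<open>Taking \<open>t = r\<close> exposes a left factor \<open>A\<^sup>r\<^sup>+\<^sup>1\<close>, on which \<open>S\<close> acts as an inverse of \<open>A\<close>.\<close>
  then have AY: "A = A \<odot> A \<up> r \<odot> Y \<up> r" using pow_Suc_left[OF A] by metis
  have "A \<odot> A \<up> r = A \<odot> (A \<odot> A \<up> r \<odot> S)" using S(3) pow_Suc_left[OF A] by simp
  also have "\<dots> = A \<odot> A \<odot> S \<odot> A \<up> r"
    using pow_commute[OF A S(1,2), of r] by (simp add: prod_assoc)
  also have "\<dots> = A \<odot> S \<odot> (A \<odot> A \<up> r)" using S(2) by (metis prod_assoc)
  finally have "A \<odot> A \<up> r \<odot> Y \<up> r = A \<odot> S \<odot> (A \<odot> A \<up> r \<odot> Y \<up> r)"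
    by (metis prod_assoc)
  then have AAS: "A = A \<odot> S \<odot> A" unfolding AY[symmetric] .
  show ?thesis by (rule that[of S]) (use S AAS in auto)
qed

section \<open>Hermitian inner inverses\<close>

text \<open>The inner product is positive definite, so \<open>M\<^sup>\<dagger> M Z = 0\<close> forces \<open>M Z = 0\<close> column by column.\<close>

lemma adj_cancel:
  assumes "M\<^sup>\<dagger> \<odot> (M \<odot> P) = M\<^sup>\<dagger> \<odot> (M \<odot> Q)"
  shows "M \<odot> P = M \<odot> Q"
proof (rule square_tensor_eqI)
  fix i j assume ij: "i \<in> I" "j \<in> I"
  define D where "D k = P (k, j) - Q (k, j)" for k
  define w where "w i = (\<Sum>k\<in>I. M (i, k) * D k)" for i
  have w: "w i = (M \<odot> P) (i, j) - (M \<odot> Q) (i, j)" if "i \<in> I" for i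
    using that ij by (simp add: w_def D_def prod_entry right_diff_distrib sum_subtractf)
  have zero: "(\<Sum>l\<in>I. cnj (M (l, k)) * w l) = 0" if "k \<in> I" for k
  proof -
    have "(\<Sum>l\<in>I. cnj (M (l, k)) * w l)
        = (M\<^sup>\<dagger> \<odot> (M \<odot> P)) (k, j) - (M\<^sup>\<dagger> \<odot> (M \<odot> Q)) (k, j)"
      using that ij(2)
      by (simp add: prod_entry[of k j] adj_entry w right_diff_distrib sum_subtractf)
    then show ?thesis using assms by simp
  qed
  have cnj_w: "cnj (w l) = (\<Sum>k\<in>I. cnj (D k) * cnj (M (l, k)))" for l
    by (simp add: w_def mult.commute)
  have "complex_of_real (\<Sum>l\<in>I. (cmod (w l))\<^sup>2) = (\<Sum>l\<in>I. cnj (w l) * w l)"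
    unfolding of_real_sum complex_norm_square by (simp only: mult.commute)
  also have "\<dots> = (\<Sum>l\<in>I. \<Sum>k\<in>I. cnj (D k) * (cnj (M (l, k)) * w l))"
    by (simp only: cnj_w sum_distrib_right mult.assoc)
  also have "\<dots> = (\<Sum>k\<in>I. cnj (D k) * (\<Sum>l\<in>I. cnj (M (l, k)) * w l))"
    by (subst sum.swap) (simp add: sum_distrib_left)
  also have "\<dots> = 0" using zero by simp
  finally have "(\<Sum>l\<in>I. (cmod (w l))\<^sup>2) = 0" using of_real_eq_0_iff by blast
  then have "w i = 0"
    using ij finite_multi_indices by (simp add: sum_nonneg_eq_0_iff)
  then show "(M \<odot> P) (i, j) = (M \<odot> Q) (i, j)" using w ij by simp
qed auto

lemma hermitian_inner_inverse:
  assumes A: "A \<in> T"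
  obtains X where "X \<in> T" "A \<odot> X \<odot> A = A" "(A \<odot> X)\<^sup>\<dagger> = A \<odot> X"
proof -
  define H where "H = A\<^sup>\<dagger> \<odot> A"
  have H: "H \<in> T" "H\<^sup>\<dagger> = H" using A by (auto simp: H_def adj_prod adj_adj)
  obtain r S where S: "S \<in> T" "H \<odot> S = S \<odot> H" "H \<up> r = H \<up> Suc r \<odot> S"
    using strongly_pi_regular[OF H(1)] by blast
  have cancel: "H \<odot> P = H \<odot> Q" if "H \<up> Suc t \<odot> P = H \<up> Suc t \<odot> Q" for t P Q
    using that
  proof (induction t)
    case (Suc t)
    then have "H \<odot> (H \<odot> (H \<up> t \<odot> P)) = H \<odot> (H \<odot> (H \<up> t \<odot> Q))"
      using pow_Suc_left[OF H(1)] by (metis prod_assoc)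
    then have "H \<odot> (H \<up> t \<odot> P) = H \<odot> (H \<up> t \<odot> Q)"
      using adj_cancel[of H] H(2) by metis
    then show ?case using Suc.IH pow_Suc_left[OF H(1)] by (metis prod_assoc)
  qed (use H in simp)
  have "H \<up> Suc r \<odot> (H \<odot> S) = H \<up> Suc r \<odot> \<one>"
    using S(3) pow_Suc_left[OF H(1)] prod_assoc tensor_power.simps(2) prod_one pow_in by metis
  then have "H \<odot> (H \<odot> S) = H \<odot> \<one>" by (rule cancel)
  then have "A\<^sup>\<dagger> \<odot> (A \<odot> (H \<odot> S)) = A\<^sup>\<dagger> \<odot> (A \<odot> \<one>)" by (simp add: H_def prod_assoc)
  then have "A \<odot> (H \<odot> S) = A" using adj_cancel A prod_one by metis
  then have "A \<odot> (S \<odot> H) = A" using S(2) by simp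
  then have normal: "H \<odot> (S\<^sup>\<dagger> \<odot> A\<^sup>\<dagger>) = A\<^sup>\<dagger>"
    using H(2) by (metis adj_prod prod_assoc)
  define X where "X = S\<^sup>\<dagger> \<odot> A\<^sup>\<dagger>"
  have AX: "A\<^sup>\<dagger> \<odot> (A \<odot> X) = A\<^sup>\<dagger>" using normal by (simp add: X_def H_def prod_assoc)
  have "(A \<odot> X)\<^sup>\<dagger> = (A \<odot> X)\<^sup>\<dagger> \<odot> (A \<odot> X)"
    using AX by (simp add: adj_prod prod_assoc)
  then have herm: "(A \<odot> X)\<^sup>\<dagger> = A \<odot> X"
    by (metis adj_prod adj_adj prod_in)
  moreover have "A \<odot> X \<odot> A = A"
    using arg_cong[OF AX, of "conj_transpose n N"] herm A by (simp add: adj_prod adj_adj)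
  ultimately show ?thesis using that[of X] by (auto simp: X_def)
qed

section \<open>The core inverse\<close>

lemma core_inverse_inner:
  assumes "A \<in> T" "is_core_inverse n N A X"
  shows "A \<odot> X \<odot> A = A"
proof -
  have X: "X \<in> T" "X \<odot> (A \<odot> A) = A" "A \<odot> (X \<odot> X) = X"
    using assms by (auto simp: is_core_inverse_def pow_two)
  have "A \<odot> X \<odot> A = A \<odot> X \<odot> (X \<odot> (A \<odot> A))" using X(2) by simp
  also have "\<dots> = A \<odot> (X \<odot> X) \<odot> (A \<odot> A)" by (simp add: prod_assoc)
  also have "\<dots> = A" using X(2,3) by simp
  finally show ?thesis .
qed

lemma core_inverse_unique:
  assumes A: "A \<in> T" and "is_core_inverse n N A X" "is_core_inverse n N A Y"
  shows "X = Y"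
proof -
  have X: "(A \<odot> X)\<^sup>\<dagger> = A \<odot> X" "X \<odot> (A \<odot> A) = A" "A \<odot> (X \<odot> X) = X"
    and Y: "(A \<odot> Y)\<^sup>\<dagger> = A \<odot> Y" "Y \<odot> (A \<odot> A) = A" "A \<odot> (Y \<odot> Y) = Y"
    using assms by (auto simp: is_core_inverse_def pow_two)
  have inner: "A \<odot> X \<odot> A = A" "A \<odot> Y \<odot> A = A"
    using core_inverse_inner assms by auto
  \<comment> \<open>Both \<open>A X\<close> and \<open>A Y\<close> are the orthogonal projector onto the range of \<open>A\<close>.\<close>
  have "A \<odot> Y = (A \<odot> X) \<odot> (A \<odot> Y)" using inner(1) by (metis prod_assoc)
  then have "A \<odot> Y = (A \<odot> Y) \<odot> (A \<odot> X)" using X(1) Y(1) adj_prod by metis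
  then have proj: "A \<odot> X = A \<odot> Y" using inner(2) by (metis prod_assoc)
  have absorb: "X \<odot> (A \<odot> Z) = Z" if "A \<odot> (Z \<odot> Z) = Z" for Z
    using that X(2) by (metis prod_assoc)
  have "X = X \<odot> (A \<odot> X)" using absorb[OF X(3)] by simp
  also have "\<dots> = Y" using proj absorb[OF Y(3)] by simp
  finally show ?thesis .
qed

text \<open>With \<open>G\<close> an inner inverse commuting with \<open>A\<close> and \<open>A X\<close> the orthogonal projector onto the range
  of \<open>A\<close>, the tensor \<open>G A X\<close> first projects onto the range and then inverts \<open>A\<close> there.\<close>

lemma core_inverse_exists:
  assumes "core_tensor n N A"
  obtains X where "is_core_inverse n N A X"
proof -
  have A: "A \<in> T" using assms by (simp add: core_tensor_def)
  obtain G where G: "G \<in> T" "A \<odot> G = G \<odot> A" "A \<odot> G \<odot> A = A"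
    using core_tensor_commuting_inner_inverse[OF assms] by blast
  obtain X where X: "X \<in> T" "A \<odot> X \<odot> A = A" "(A \<odot> X)\<^sup>\<dagger> = A \<odot> X"
    using hermitian_inner_inverse[OF A] by blast
  define C where "C = G \<odot> A \<odot> X"
  have "A \<odot> C = A \<odot> G \<odot> A \<odot> X" by (simp add: C_def prod_assoc)
  then have AC: "A \<odot> C = A \<odot> X" using G(3) by simp
  have "C \<odot> (A \<odot> A) = G \<odot> (A \<odot> X \<odot> A) \<odot> A" by (simp add: C_def prod_assoc)
  also have "\<dots> = A" using X(2) G(2,3) by simp
  finally have CAA: "C \<odot> (A \<odot> A) = A" .
  have "A \<odot> (C \<odot> C) = A \<odot> X \<odot> C" using AC by (metis prod_assoc)
  also have "\<dots> = A \<odot> X \<odot> (A \<odot> G \<odot> X)" using G(2) by (simp add: C_def)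
  also have "\<dots> = A \<odot> X \<odot> A \<odot> G \<odot> X" by (simp add: prod_assoc)
  also have "\<dots> = C" using X(2) G(2) by (simp add: C_def)
  finally have ACC: "A \<odot> (C \<odot> C) = C" .
  have "C \<in> T" by (simp add: C_def)
  with A AC CAA ACC X(3) have "is_core_inverse n N A C"
    by (simp add: is_core_inverse_def pow_two)
  then show ?thesis by (rule that)
qed

lemma core_inverse_is_core_inverse:
  assumes "core_tensor n N A"
  shows "is_core_inverse n N A (core_inverse n N A)"
proof -
  obtain X where "is_core_inverse n N A X" using core_inverse_exists[OF assms] .
  moreover have "A \<in> T" using assms by (simp add: core_tensor_def)
  ultimately show ?thesis unfolding core_inverse_def by (metis theI core_inverse_unique)
qed

end

section \<open>Solving the equation\<close>

theorem theorem5p4: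
  fixes n :: nat and N :: "nat \<Rightarrow> nat"
    and A :: "multi_index \<times> multi_index \<Rightarrow> complex"
    and B :: "multi_index \<Rightarrow> complex"
  assumes "n \<ge> 1" and "\<forall>k\<in>{1..n}. N k \<ge> 1"
    and "A \<in> square_tensors n N" and "core_tensor n N A"
    and "B \<in> tensors n N" and "B \<in> tensor_range n N A"
  shows "(\<exists>!X. X \<in> tensor_range n N A \<and> einstein_app n N A X = B) \<and>
    einstein_app n N (core_inverse n N A) B \<in> tensor_range n N A \<and>
    einstein_app n N A (einstein_app n N (core_inverse n N A) B) = B"
proof -
  define C where "C = core_inverse n N A"
  have core: "is_core_inverse n N A C"
    unfolding C_def using assms(4) by (rule core_inverse_is_core_inverse)
  have CAA: "einstein_prod n N C (einstein_prod n N A A) = A"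
    and ACC: "einstein_prod n N A (einstein_prod n N C C) = C"
    using core assms(3) by (auto simp: is_core_inverse_def pow_two)
  have ACA: "einstein_prod n N (einstein_prod n N A C) A = A"
    using core_inverse_inner[OF assms(3) core] .
  have "einstein_app n N C B = einstein_app n N A (einstein_app n N (einstein_prod n N C C) B)"
    by (simp add: app_app ACC)
  then have in_range: "einstein_app n N C B \<in> tensor_range n N A"
    unfolding tensor_range_def using app_in by blast
  obtain Z where "B = einstein_app n N A Z" using assms(6) by (auto simp: tensor_range_def)
  then have solves: "einstein_app n N A (einstein_app n N C B) = B"
    by (metis app_app ACA)
  have unique: "X = einstein_app n N C B"
    if X: "X \<in> tensor_range n N A" "einstein_app n N A X = B" for X
  proof -
    from X(1) obtain W where "X = einstein_app n N A W" by (auto simp: tensor_range_def)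
    with X(2) show ?thesis by (metis app_app CAA)
  qed
  show ?thesis using in_range solves unique unfolding C_def[symmetric] by blast
qed

end
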